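(* Let $X\neq\{0\}$ be a complex Banach space with open unit ball $\mathbb{B}$, and let $\mathcal{B}_1(X)$ be the set of mappings $F:\mathbb{B}\to X$ of the form $F(x)=f(x)x$ with $f:\mathbb{B}\to\mathbb{C}$ holomorphic, $f(0)=1$ and $\|F\|_{\mathcal{B}}=1$. Let $\mathbf{B}^*_X=\inf\{r(F):F\in\mathcal{B}_1(X)\}$. (i) If $F\in\mathcal{B}_1(X)$, then $$\Re\, l_x(DF(x)x)\ge\frac{1-\sqrt3\,\|x\|}{\left(1-\frac{1}{\sqrt3}\|x\|\right)^3}\,\|x\|\qquad\text{for all } x \text{ with } 0<\|x\|\le\frac1{\sqrt3}\text{ and all } l_x\in T(x).$$ (ii) $\mathbf{B}^*_X\ge\frac{\sqrt3}{4}$.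
   Context: $DF(x)$ is the Fréchet derivative of $F$ at $x$. For holomorphic $F:\mathbb{B}\to X$, $$\|F\|_{\mathcal{B}}=\|F(0)\|+\sup_{x\in\mathbb{B}\setminus\{0\}}(1-\|x\|^2)\frac{\|DF(x)x\|}{\|x\|}.$$ For $x\in X\setminus\{0\}$, $T(x)$ is the set of continuous linear functionals $l_x:X\to\mathbb{C}$ with $l_x(x)=\|x\|$ and $\|l_x\|=1$. For $a\in\mathbb{B}$, a schlicht ball of $F$ centered at $F(a)$ is a ball in $X$ with center $F(a)$ such that $F$ maps some open subset of $\mathbb{B}$ containing $a$ biholomorphically (bijectively with holomorphic inverse) onto this ball; $r(a;F)$ is the radius of the largest schlicht ball of $F$ centered at $F(a)$ (the supremum of such radii, $0$ if there is none), and $r(F)=\sup\{r(a;F):a\in\mathbb{B}\}$. *)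

theory Defs
  imports "HOL-Analysis.Analysis"
begin

class complex_normed_vector = real_normed_vector +
  fixes scaleC :: "complex \<Rightarrow> 'a \<Rightarrow> 'a" (infixr "*\<^sub>C" 75)
  assumes scaleC_add_right: "c *\<^sub>C (x + y) = c *\<^sub>C x + c *\<^sub>C y"
    and scaleC_add_left: "(c + d) *\<^sub>C x = c *\<^sub>C x + d *\<^sub>C x"
    and scaleC_scaleC: "c *\<^sub>C d *\<^sub>C x = (c * d) *\<^sub>C x"
    and scaleC_one: "1 *\<^sub>C x = x"
    and scaleR_scaleC: "r *\<^sub>R x = complex_of_real r *\<^sub>C x"
    and norm_scaleC: "norm (c *\<^sub>C x) = cmod c * norm x"

class complex_banach = complex_normed_vector + banach

instantiation complex :: complex_banach
begin

definition scaleC_complex_def: "c *\<^sub>C (z::complex) = c * z"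

instance
  by standard (simp_all add: scaleC_complex_def algebra_simps norm_mult scaleR_conv_of_real)

end

definition bounded_clinear :: "('a::complex_normed_vector \<Rightarrow> 'b::complex_normed_vector) \<Rightarrow> bool"
  where "bounded_clinear L \<longleftrightarrow> bounded_linear L \<and> (\<forall>c v. L (c *\<^sub>C v) = c *\<^sub>C L v)"

text \<open>
  Complex Frechet differentiability at every point of an open set. The library's
  \<^const>\<open>has_derivative\<close> only asks for a real-linear derivative, so complex linearity is
  added; where it holds, \<^const>\<open>frechet_derivative\<close> is the (unique) complex Frechet derivative.
\<close>

definition cholomorphic_on ::
    "('a::complex_normed_vector \<Rightarrow> 'b::complex_normed_vector) \<Rightarrow> 'a set \<Rightarrow> bool"
  where "cholomorphic_on F S \<longleftrightarrow>
    open S \<and> (\<forall>x\<in>S. \<exists>L. bounded_clinear L \<and> (F has_derivative L) (at x))"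

text \<open>
  The Bloch norm, the schlicht radii and the Bloch constant are extended reals, because the
  suprema need not be finite. A mapping of the open unit ball is a total function, of which
  only the values on \<^term>\<open>ball 0 1\<close> matter.
\<close>

definition bloch_norm :: "('a::complex_normed_vector \<Rightarrow> 'a) \<Rightarrow> ereal"
  where "bloch_norm F = ereal (norm (F 0)) +
    (SUP x \<in> ball 0 1 - {0}.
       ereal ((1 - (norm x)\<^sup>2) * (norm (frechet_derivative F (at x) x) / norm x)))"

definition support_functionals :: "'a::complex_normed_vector \<Rightarrow> ('a \<Rightarrow> complex) set"
  where "support_functionals x =
    {l. bounded_clinear l \<and> l x = complex_of_real (norm x) \<and> onorm l = 1}"

definition biholomorphic_onto ::
    "('a::complex_normed_vector \<Rightarrow> 'b::complex_normed_vector) \<Rightarrow> 'a set \<Rightarrow> 'b set \<Rightarrow> bool"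
  where "biholomorphic_onto F U V \<longleftrightarrow>
    bij_betw F U V \<and> cholomorphic_on F U \<and> cholomorphic_on (inv_into U F) V"

definition schlicht_ball :: "('a::complex_normed_vector \<Rightarrow> 'a) \<Rightarrow> 'a \<Rightarrow> real \<Rightarrow> bool"
  where "schlicht_ball F a \<rho> \<longleftrightarrow>
    \<rho> > 0 \<and> (\<exists>U. open U \<and> a \<in> U \<and> U \<subseteq> ball 0 1 \<and> biholomorphic_onto F U (ball (F a) \<rho>))"

definition schlicht_radius_at :: "'a::complex_normed_vector \<Rightarrow> ('a \<Rightarrow> 'a) \<Rightarrow> ereal"
  where "schlicht_radius_at a F = Sup (insert 0 {ereal \<rho> |\<rho>. schlicht_ball F a \<rho>})"

definition schlicht_radius :: "('a::complex_normed_vector \<Rightarrow> 'a) \<Rightarrow> ereal"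
  where "schlicht_radius F = (SUP a \<in> ball 0 1. schlicht_radius_at a F)"

definition bloch_class :: "('a::complex_normed_vector \<Rightarrow> 'a) set"
  where "bloch_class =
    {F. (\<exists>f :: 'a \<Rightarrow> complex. cholomorphic_on f (ball 0 1) \<and> f 0 = 1 \<and>
          (\<forall>x \<in> ball 0 1. F x = f x *\<^sub>C x)) \<and>
        bloch_norm F = 1}"

definition bloch_constant :: "'a::complex_normed_vector itself \<Rightarrow> ereal"
  where "bloch_constant _ = (INF F \<in> (bloch_class :: ('a \<Rightarrow> 'a) set). schlicht_radius F)"

end

theory Submission
  imports Defs "HOL-Complex_Analysis.Complex_Analysis"
begin

text \<open>
  For \<open>F x = f x x\<close> the radial derivative is \<open>DF(x)x = g(x) x\<close> with \<open>g(x) = f x + Df(x)x\<close>,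
  and along a unit direction \<open>u\<close> the function \<open>g(z u)\<close> is the derivative of
  the one-variable Bloch function \<open>z f(z u)\<close>. Part (i) is therefore Bonk's distortion theorem on
  each slice, obtained from Julia's boundary version of the Schwarz-Pick lemma.
  Integrating the bound gives \<open>norm (F x) \<ge> sqrt 3 / 4\<close> on the sphere of radius \<open>1 / sqrt 3\<close>,
  while \<open>Re g > 0\<close> inside makes every slice injective. Since \<open>F\<close> preserves complex lines,
  surjectivity onto the ball and the continuity of the inverse also reduce to
  slices; differentiability of the inverse follows because \<open>DF(x)\<close> is a rank-one perturbation of
  \<open>f x\<close> times the identity and is inverted explicitly.
\<close>

section \<open>Schwarz-Pick and Julia inequalities in the unit disc\<close>

lemma one_minus_norm_Moebius:
  fixes a b :: complex
  assumes "1 - cnj a * b \<noteq> 0"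
  shows "(1 - (cmod ((b - a) / (1 - cnj a * b)))\<^sup>2) * (cmod (1 - cnj a * b))\<^sup>2
    = (1 - (cmod a)\<^sup>2) * (1 - (cmod b)\<^sup>2)"
proof -
  have "(1 - (cmod ((b - a) / (1 - cnj a * b)))\<^sup>2) * (cmod (1 - cnj a * b))\<^sup>2
      = (cmod (1 - cnj a * b))\<^sup>2 - (cmod (b - a))\<^sup>2"
    using assms by (simp add: norm_divide power_divide field_simps)
  also have "\<dots> = (1 - (cmod a)\<^sup>2) * (1 - (cmod b)\<^sup>2)"
    by (simp add: cmod_power2 algebra_simps) algebra
  finally show ?thesis .
qed

lemma one_minus_cnj_mult_nz:
  fixes a b :: complex
  assumes "cmod a < 1" "cmod b < 1"
  shows "1 - cnj a * b \<noteq> 0"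
proof
  assume "1 - cnj a * b = 0"
  then have "cmod (cnj a * b) = 1" by simp
  with norm_mult_less[of "cnj a" 1 b 1] assms show False by simp
qed

text \<open>Schwarz's lemma between two disc automorphisms, with
  \<open>one_minus_norm_Moebius\<close> turning moduli of Moebius images into products. In this form
  one point can be sent to the boundary, where both sides degenerate at the rate
  \<open>1 - s\<^sup>2\<close>.\<close>

lemma Schwarz_Pick:
  assumes hol: "k holomorphic_on ball 0 1"
    and bound: "\<And>z. cmod z < 1 \<Longrightarrow> cmod (k z) < 1"
    and w: "cmod w < 1" and z: "cmod z < 1"
  shows "(cmod (1 - cnj (k w) * k z))\<^sup>2 * ((1 - (cmod w)\<^sup>2) * (1 - (cmod z)\<^sup>2))
    \<le> (cmod (1 - cnj w * z))\<^sup>2 * ((1 - (cmod (k w))\<^sup>2) * (1 - (cmod (k z))\<^sup>2))"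
proof -
  define M where "M = Moebius_function 0"
  \<comment> \<open>\<open>M (- w)\<close> inverts \<open>M w\<close>, so \<open>H\<close> sends
    \<open>M w z\<close> to \<open>M (k w) (k z)\<close> and fixes \<open>0\<close>.\<close>
  define H where "H = M (k w) \<circ> k \<circ> M (- w)"
  have maps: "M a ` ball 0 1 \<subseteq> ball 0 1" if "cmod a < 1" for a
    using that by (auto simp: M_def intro: Moebius_function_norm_lt_1)
  have holM: "M a holomorphic_on ball 0 1" if "cmod a < 1" for a
    using that by (simp add: M_def Moebius_function_holomorphic)
  have kmaps: "k ` ball 0 1 \<subseteq> ball 0 1"
    using bound by auto
  have "k \<circ> M (- w) holomorphic_on ball 0 1"
    using w maps[of "- w"] by (intro holomorphic_on_compose_gen[OF holM hol]) auto
  moreover have "(k \<circ> M (- w)) ` ball 0 1 \<subseteq> ball 0 1"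
    using w maps[of "- w"] kmaps by fastforce
  ultimately have "H holomorphic_on ball 0 1"
    unfolding H_def comp_assoc using bound[OF w]
    by (intro holomorphic_on_compose_gen[OF _ holM])
  moreover have "H 0 = 0"
    by (simp add: H_def M_def Moebius_function_simple)
  moreover have "cmod (H u) < 1" if "cmod u < 1" for u
    using that w bound by (simp add: H_def M_def Moebius_function_norm_lt_1)
  moreover have "cmod (M w z) < 1"
    using w z by (simp add: M_def Moebius_function_norm_lt_1)
  ultimately have "cmod (H (M w z)) \<le> cmod (M w z)"
    using Schwarz_Lemma(1)[of H "M w z"] by blast
  moreover have "M (- w) (M w z) = z"
    unfolding M_def by (rule Moebius_function_compose) (use w z in auto)
  ultimately have *: "cmod (M (k w) (k z)) \<le> cmod (M w z)"
    by (simp add: H_def)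
  define P where "P = (cmod (1 - cnj (k w) * k z))\<^sup>2"
  define Q where "Q = (cmod (1 - cnj w * z))\<^sup>2"
  have nz: "1 - cnj w * z \<noteq> 0" "1 - cnj (k w) * k z \<noteq> 0"
    by (rule one_minus_cnj_mult_nz; use w z bound in blast)+
  have 1: "(1 - (cmod (M w z))\<^sup>2) * Q = (1 - (cmod w)\<^sup>2) * (1 - (cmod z)\<^sup>2)"
    unfolding Q_def M_def Moebius_function_simple by (rule one_minus_norm_Moebius[OF nz(1)])
  have 2: "(1 - (cmod (M (k w) (k z)))\<^sup>2) * P = (1 - (cmod (k w))\<^sup>2) * (1 - (cmod (k z))\<^sup>2)"
    unfolding P_def M_def Moebius_function_simple by (rule one_minus_norm_Moebius[OF nz(2)])
  have "1 - (cmod (M w z))\<^sup>2 \<le> 1 - (cmod (M (k w) (k z)))\<^sup>2"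
    using * by (simp add: power_mono)
  then have "P * Q * (1 - (cmod (M w z))\<^sup>2) \<le> P * Q * (1 - (cmod (M (k w) (k z)))\<^sup>2)"
    by (rule mult_left_mono) (simp add: P_def Q_def)
  then show ?thesis
    unfolding P_def[symmetric] Q_def[symmetric] 1[symmetric] 2[symmetric]
    by (simp add: mult_ac)
qed

text \<open>Take \<open>w = s\<close> real in \<open>Schwarz_Pick\<close>, divide by
  \<open>1 - s\<^sup>2\<close> and let \<open>s\<close> increase to \<open>1\<close>;
  \<open>c\<close> is the dilation of \<open>k\<close> at the boundary fixed point
  \<open>1\<close>.\<close>

lemma Julia_radial:
  assumes hol: "k holomorphic_on ball 0 1"
    and bound: "\<And>z. cmod z < 1 \<Longrightarrow> cmod (k z) < 1"
    and lim: "((\<lambda>s::real. k (of_real s)) \<longlongrightarrow> 1) (at_left 1)"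
    and quot: "((\<lambda>s::real. (1 - (cmod (k (of_real s)))\<^sup>2) / (1 - s\<^sup>2)) \<longlongrightarrow> c) (at_left 1)"
    and z: "cmod z < 1"
  shows "(cmod (1 - k z))\<^sup>2 * (1 - (cmod z)\<^sup>2) \<le> c * (cmod (1 - z))\<^sup>2 * (1 - (cmod (k z))\<^sup>2)"
proof (rule tendsto_le[of "at_left (1::real)"])
  show "((\<lambda>s::real. (cmod (1 - cnj (k (of_real s)) * k z))\<^sup>2 * (1 - (cmod z)\<^sup>2))
      \<longlongrightarrow> (cmod (1 - k z))\<^sup>2 * (1 - (cmod z)\<^sup>2)) (at_left 1)"
    using lim by (auto intro!: tendsto_eq_intros)
  have "((\<lambda>s::real. (1 - (cmod (k (of_real s)))\<^sup>2) / (1 - s\<^sup>2) * (cmod (1 - cnj (of_real s) * z))\<^sup>2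
          * (1 - (cmod (k z))\<^sup>2))
      \<longlongrightarrow> c * (cmod (1 - cnj (of_real 1) * z))\<^sup>2 * (1 - (cmod (k z))\<^sup>2)) (at_left 1)"
    by (intro tendsto_intros quot)
  then show "((\<lambda>s::real. (1 - (cmod (k (of_real s)))\<^sup>2) / (1 - s\<^sup>2) * (cmod (1 - of_real s * z))\<^sup>2
          * (1 - (cmod (k z))\<^sup>2))
      \<longlongrightarrow> c * (cmod (1 - z))\<^sup>2 * (1 - (cmod (k z))\<^sup>2)) (at_left 1)"
    by simp
  have "\<forall>\<^sub>F s in at_left (1::real). s \<in> {0<..<1}"
    by (rule eventually_at_leftI[of 0]) auto
  then show "\<forall>\<^sub>F s in at_left (1::real).
      (cmod (1 - cnj (k (of_real s)) * k z))\<^sup>2 * (1 - (cmod z)\<^sup>2)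
      \<le> (1 - (cmod (k (of_real s)))\<^sup>2) / (1 - s\<^sup>2) * (cmod (1 - of_real s * z))\<^sup>2
          * (1 - (cmod (k z))\<^sup>2)"
  proof eventually_elim
    case (elim s)
    then have "0 < 1 - s\<^sup>2"
      by (simp add: power2_eq_square) (metis less_eq_real_def mult_less_cancel_left2 mult_strict_mono mult_1 not_less)
    then show ?case
      using Schwarz_Pick[OF hol bound, of "of_real s" z] elim z
      by (simp add: field_simps)
  qed
qed simp

text \<open>The inequality places \<open>w\<close> in the horodisc at \<open>1\<close> through
  \<open>t\<close>, which is the Euclidean disc with diameter from \<open>t\<close> to
  \<open>1\<close>; its leftmost point is \<open>t\<close>.\<close>

lemma Re_ge_of_horodisc:
  fixes w :: complex
  assumes t: "-1 < t" "t < 1" and w: "cmod w < 1"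
    and le: "(cmod (1 - w))\<^sup>2 * (1 - t\<^sup>2) \<le> (1 - t)\<^sup>2 * (1 - (cmod w)\<^sup>2)"
  shows "t \<le> Re w"
proof -
  have "(1 - t) * ((cmod (1 - w))\<^sup>2 * (1 + t)) \<le> (1 - t) * ((1 - t) * (1 - (cmod w)\<^sup>2))"
    using le by (simp add: power2_eq_square algebra_simps)
  then have *: "(cmod (1 - w))\<^sup>2 * (1 + t) \<le> (1 - t) * (1 - (cmod w)\<^sup>2)"
    using t by simp
  have "Re w < 1"
    using w complex_Re_le_cmod[of w] by linarith
  moreover have "2 * ((1 - Re w) * (t - Re w)) \<le> - 2 * (Im w)\<^sup>2"
    using * unfolding cmod_power2 by (simp add: power2_eq_square algebra_simps)
  then have "(1 - Re w) * (t - Re w) \<le> 0"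
    using zero_le_power2[of "Im w"] by linarith
  ultimately show ?thesis
    by (simp add: mult_le_0_iff)
qed

section \<open>Bonk's distortion theorem in one variable\<close>

text \<open>In the transported picture the normalisation at \<open>0\<close> becomes a boundary
  fixed point with dilation exactly \<open>1\<close>. Julia's lemma then bounds the real part at the
  preimage of \<open>x\<close>. The point \<open>x = 0\<close> corresponds to the boundary point
  itself and is treated separately.\<close>

theorem Bonk_distortion:
  fixes g :: "complex \<Rightarrow> complex" and x :: real
  assumes hol: "g holomorphic_on ball 0 1" and g0: "g 0 = 1"
    and bound: "\<And>z. cmod z < 1 \<Longrightarrow> (1 - (cmod z)\<^sup>2) * cmod (g z) \<le> 1"
    and x: "0 \<le> x" "x \<le> 1 / sqrt 3"
  shows "(1 - sqrt 3 * x) / (1 - 1 / sqrt 3 * x) ^ 3 \<le> Re (g (of_real x))"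
proof (cases "x = 0")
  case True
  then show ?thesis by (simp add: g0)
next
  case False
  with x have xpos: "0 < x" by simp
  define q where "q = sqrt 3"
  have q2: "q * q = 3" and q0: "0 < q" by (simp_all add: q_def)
  \<comment> \<open>\<open>\<phi> z\<close> is the image of \<open>z / sqrt 3\<close> under the Moebius involution exchanging \<open>0\<close> and \<open>1 / sqrt 3\<close>,
    and \<open>k\<close> is the correspondingly transported (and normalised) derivative: \<open>0\<close> goes to the
    boundary point \<open>1\<close>, where Julia's lemma applies.\<close>
  define \<phi> where "\<phi> = (\<lambda>z. of_real q * (1 - z) / (3 - z) :: complex)"
  define k where "k = (\<lambda>z. 4 * g (\<phi> z) / (3 - z)\<^sup>2)"
  have \<phi>_bound: "cmod (\<phi> z) < 1 \<and> (1 - (cmod (\<phi> z))\<^sup>2) * (cmod (3 - z))\<^sup>2 = 6 - 2 * (cmod z)\<^sup>2 \<and> z \<noteq> 3"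
    if z: "cmod z < q" for z
  proof -
    have z2: "(cmod z)\<^sup>2 < 3"
      using power_strict_mono[OF z norm_ge_zero, of 2] q2 by (simp add: power2_eq_square)
    have z3: "z \<noteq> 3"
      using z2 by auto
    have "(1 - (cmod (\<phi> z))\<^sup>2) * (cmod (3 - z))\<^sup>2 = (cmod (3 - z))\<^sup>2 - q\<^sup>2 * (cmod (1 - z))\<^sup>2"
      using z3 q0
      by (simp add: \<phi>_def norm_divide norm_mult power_divide power_mult_distrib left_diff_distrib)
    also have "\<dots> = 6 - 2 * (cmod z)\<^sup>2"
      using q2 unfolding cmod_power2 by (simp add: power2_eq_square algebra_simps)
    finally have e: "(1 - (cmod (\<phi> z))\<^sup>2) * (cmod (3 - z))\<^sup>2 = 6 - 2 * (cmod z)\<^sup>2" .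
    then have "0 < (1 - (cmod (\<phi> z))\<^sup>2) * (cmod (3 - z))\<^sup>2"
      using z2 by simp
    then have "(cmod (\<phi> z))\<^sup>2 < 1\<^sup>2"
      by (simp add: zero_less_mult_iff)
    then have "cmod (\<phi> z) < 1"
      by (rule power_less_imp_less_base) simp
    with e z3 show ?thesis by blast
  qed
  \<comment> \<open>This is the Bloch bound in the new coordinate. The majorant is below
    \<open>1\<close> inside the unit disc and equals \<open>1\<close> on the unit circle. It holds
    up to radius \<open>q > 1\<close>, hence on both sides of the point \<open>1\<close>.\<close>
  have k_bound: "cmod (k z) \<le> 2 / (3 - (cmod z)\<^sup>2)" if z: "cmod z < q" for z
  proof -
    note b = \<phi>_bound[OF z]
    have z2: "(cmod z)\<^sup>2 < 3"
      using power_strict_mono[OF z norm_ge_zero, of 2] q2 by (simp add: power2_eq_square)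
    have "(6 - 2 * (cmod z)\<^sup>2) * cmod (k z)
        = 4 * ((1 - (cmod (\<phi> z))\<^sup>2) * cmod (g (\<phi> z)))"
      using b by (simp add: k_def norm_divide norm_mult norm_power flip: b[THEN conjunct2, THEN conjunct1])
    also have "\<dots> \<le> 4"
      using bound[of "\<phi> z"] b by simp
    finally show ?thesis
      using z2 by (simp add: field_simps)
  qed
  have q1: "1 < q"
    by (simp add: q_def)
  have hol\<phi>: "\<phi> holomorphic_on ball 0 q"
    unfolding \<phi>_def using \<phi>_bound by (auto intro!: holomorphic_intros)
  have "(g \<circ> \<phi>) holomorphic_on ball 0 q"
    using \<phi>_bound by (intro holomorphic_on_compose_gen[OF hol\<phi> hol]) auto
  then have holk: "k holomorphic_on ball 0 q"
    unfolding k_def o_def using \<phi>_bound by (auto intro!: holomorphic_intros)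
  have k_less: "cmod (k z) < 1" if z: "cmod z < 1" for z
  proof -
    have "(cmod z)\<^sup>2 < 1"
      using power_strict_mono[OF z norm_ge_zero, of 2] by simp
    then have "2 / (3 - (cmod z)\<^sup>2) < 1"
      by (simp add: field_simps)
    with k_bound[of z] z q1 show ?thesis by simp
  qed
  have k1: "k 1 = 1"
    by (simp add: k_def \<phi>_def g0)
  define N where "N = (\<lambda>s::real. (cmod (k (of_real s)))\<^sup>2)"
  have "k field_differentiable at 1"
    using holk q1 by (auto intro!: holomorphic_on_imp_differentiable_at[of k "ball 0 q"])
  then obtain k' where k': "(k has_field_derivative k') (at 1)"
    by (auto simp: field_differentiable_def)
  have kr: "((\<lambda>s::real. k (of_real s)) has_vector_derivative k') (at 1)"
    using k' has_vector_derivative_real_field[of k k' 1 UNIV] by simp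
  have cont: "((\<lambda>s::real. k (of_real s)) \<longlongrightarrow> 1) (at 1)"
    using has_vector_derivative_continuous[OF kr] k1 by (simp add: continuous_at)
  have "((\<lambda>s. (Re (k (of_real s)))\<^sup>2 + (Im (k (of_real s)))\<^sup>2) has_real_derivative (2 * Re k')) (at 1)"
    using k1 kr
    by (auto intro!: derivative_eq_intros)
  then have derN: "(N has_real_derivative (2 * Re k')) (at 1)"
    by (simp add: N_def cmod_power2)
  \<comment> \<open>\<open>N\<close> touches its majorant \<open>(2 / (3 - s\<^sup>2))\<^sup>2\<close> at \<open>s = 1\<close>, so the derivatives there agree.\<close>
  have "2 * Re k' - 2 = 0"
  proof (rule DERIV_local_max)
    show "((\<lambda>s. N s - (2 / (3 - s\<^sup>2))\<^sup>2) has_real_derivative 2 * Re k' - 2) (at 1)"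
      by (auto intro!: derivative_eq_intros derN simp: power2_eq_square)
    show "0 < q - 1" using q1 by simp
    show "\<forall>y. \<bar>1 - y\<bar> < q - 1 \<longrightarrow> N y - (2 / (3 - y\<^sup>2))\<^sup>2 \<le> N 1 - (2 / (3 - 1\<^sup>2))\<^sup>2"
    proof (intro allI impI)
      fix y assume "\<bar>1 - y\<bar> < q - 1"
      then have "\<bar>y\<bar> < q" by linarith
      then have "cmod (k (of_real y)) \<le> 2 / (3 - y\<^sup>2)"
        using k_bound[of "of_real y"] by simp
      then show "N y - (2 / (3 - y\<^sup>2))\<^sup>2 \<le> N 1 - (2 / (3 - 1\<^sup>2))\<^sup>2"
        by (simp add: N_def k1 power_mono)
    qed
  qed
  with derN have "(N has_real_derivative 2) (at 1)"
    by simp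
  then have "((\<lambda>s. (N s - N 1) / (s - 1)) \<longlongrightarrow> 2) (at_left 1)"
    unfolding has_field_derivative_iff by (rule filterlim_mono) (auto simp: at_le)
  \<comment> \<open>The factorisation of \<open>1 - s\<^sup>2\<close> turns the derivative
    \<open>2\<close> of \<open>N\<close> into the dilation \<open>2 / 2 = 1\<close> required by
    Julia's lemma.\<close>
  then have "((\<lambda>s. (N s - N 1) / (s - 1) / (1 + s)) \<longlongrightarrow> 2 / (1 + 1)) (at_left 1)"
    by (intro tendsto_divide tendsto_intros) auto
  then have "((\<lambda>s. (N s - N 1) / (s - 1) / (1 + s)) \<longlongrightarrow> 1) (at_left 1)"
    by simp
  then have quot: "((\<lambda>s. (1 - N s) / (1 - s\<^sup>2)) \<longlongrightarrow> 1) (at_left 1)"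
  proof (rule Lim_transform_eventually)
    have "\<forall>\<^sub>F s in at_left (1::real). s \<in> {0<..<1}"
      by (rule eventually_at_leftI[of 0]) auto
    then show "\<forall>\<^sub>F s in at_left 1. (N s - N 1) / (s - 1) / (1 + s) = (1 - N s) / (1 - s\<^sup>2)"
    proof eventually_elim
      case (elim s)
      have "N 1 = 1" by (simp add: N_def k1)
      then have "(N s - N 1) / (s - 1) / (1 + s) = (N s - 1) / ((s - 1) * (1 + s))"
        by simp
      also have "\<dots> = (1 - N s) / - ((s - 1) * (1 + s))"
        by (metis minus_diff_eq minus_divide_divide)
      also have "- ((s - 1) * (1 + s)) = 1 - s\<^sup>2"
        by (simp add: power2_eq_square algebra_simps)
      finally show ?case .
    qed
  qed
  \<comment> \<open>The solution of \<open>\<phi> t = x\<close>; the range of \<open>x\<close> puts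
    it between \<open>0\<close> (included) and \<open>1\<close> (excluded).\<close>
  define t where "t = (q - 3 * x) / (q - x)"
  have "x * q \<le> 1"
    using x by (simp add: q_def field_simps)
  then have "3 * x \<le> q"
    using mult_right_mono[of "x * q" 1 q] q0 q2 by (simp add: mult.assoc)
  then have t: "0 \<le> t" "t < 1" and xq: "x < q"
    using xpos by (auto simp: t_def field_simps)
  have "(cmod (1 - k t))\<^sup>2 * (1 - (cmod (of_real t))\<^sup>2)
      \<le> 1 * (cmod (1 - of_real t))\<^sup>2 * (1 - (cmod (k t))\<^sup>2)"
  proof (rule Julia_radial)
    show "k holomorphic_on ball 0 1"
      using holk q1 by (rule_tac holomorphic_on_subset) auto
    show "((\<lambda>s::real. k (of_real s)) \<longlongrightarrow> 1) (at_left 1)"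
      using cont by (rule filterlim_mono) (auto simp: at_le)
  qed (use k_less quot t in \<open>auto simp: N_def\<close>)
  moreover have "cmod (1 - of_real t) = 1 - t"
    using t by (metis abs_of_nonneg diff_ge_0_iff_ge less_imp_le norm_of_real of_real_1 of_real_diff)
  ultimately have "t \<le> Re (k t)"
    using t k_less[of "of_real t"] by (intro Re_ge_of_horodisc) auto
  moreover have "3 - t = 2 * q / (q - x)" and "1 - t = 2 * x / (q - x)"
    using xq by (simp_all add: t_def field_simps)
  moreover from this have "\<phi> t = x"
  proof -
    have "\<phi> t = of_real (q * (1 - t) / (3 - t))"
      by (simp add: \<phi>_def)
    also have "q * (1 - t) / (3 - t) = x"
      using \<open>3 - t = _\<close> \<open>1 - t = _\<close> q0 xq by simp
    finally show ?thesis .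
  qed
  then have "Re (k t) = 4 * Re (g x) / (3 - t)\<^sup>2"
  proof -
    have "k t = of_real (4 / (3 - t)\<^sup>2) * g x"
      by (simp add: k_def \<open>\<phi> t = x\<close>)
    then show ?thesis by simp
  qed
  ultimately have "t \<le> 4 * Re (g x) / (2 * q / (q - x))\<^sup>2"
    by simp
  also have "\<dots> = Re (g x) * (q - x)\<^sup>2 / 3"
  proof -
    have "(2 * q / (q - x))\<^sup>2 = 4 * (q * q) / (q - x)\<^sup>2"
      by (simp add: power_divide power2_eq_square)
    then show ?thesis
      by (simp add: q2)
  qed
  finally have le: "3 * t / (q - x)\<^sup>2 \<le> Re (g x)"
    using xq by (simp add: field_simps)
  have "(1 - q * x) / (1 - 1 / q * x) ^ 3 = 3 * t / (q - x)\<^sup>2"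
  proof -
    have 1: "1 - 1 / q * x = (q - x) / q"
      using q0 by (simp add: field_simps)
    have 2: "1 - q * x = (q - 3 * x) / q"
      using q0 q2 by (simp add: field_simps)
    show ?thesis
      unfolding 1 2 t_def using q0 q2 xq
      by (simp add: power2_eq_square power3_eq_cube divide_simps)
  qed
  with le show ?thesis
    by (simp add: q_def)
qed

section \<open>Complex scalar multiplication, radial maps and their slices\<close>

lemma scaleC_zero_left [simp]: "0 *\<^sub>C (x::'a::complex_normed_vector) = 0"
  using norm_scaleC[of 0 x] by simp

lemma scaleC_zero_right [simp]: "c *\<^sub>C (0::'a::complex_normed_vector) = 0"
  using norm_scaleC[of c "0::'a"] by simp

lemma bounded_bilinear_scaleC:
  "bounded_bilinear (scaleC :: complex \<Rightarrow> 'a::complex_normed_vector \<Rightarrow> 'a)"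
proof
  fix r :: real and c d :: complex and x y :: 'a
  show "(c + d) *\<^sub>C x = c *\<^sub>C x + d *\<^sub>C x" by (rule scaleC_add_left)
  show "c *\<^sub>C (x + y) = c *\<^sub>C x + c *\<^sub>C y" by (rule scaleC_add_right)
  show "(r *\<^sub>R c) *\<^sub>C x = r *\<^sub>R (c *\<^sub>C x)"
    by (simp add: scaleR_scaleC scaleC_scaleC scaleC_complex_def)
  show "c *\<^sub>C (r *\<^sub>R x) = r *\<^sub>R (c *\<^sub>C x)"
    by (simp add: scaleR_scaleC scaleC_scaleC mult.commute)
  have "\<forall>(c::complex) (x::'a). norm (c *\<^sub>C x) \<le> norm c * norm x * 1"
    by (simp add: norm_scaleC)
  then show "\<exists>K. \<forall>(c::complex) (x::'a). norm (c *\<^sub>C x) \<le> norm c * norm x * K" ..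
qed

lemmas has_derivative_scaleC = bounded_bilinear.FDERIV[OF bounded_bilinear_scaleC]
lemmas tendsto_scaleC = bounded_bilinear.tendsto[OF bounded_bilinear_scaleC]
lemmas bounded_linear_scaleC_left = bounded_bilinear.bounded_linear_left[OF bounded_bilinear_scaleC]
lemmas bounded_linear_scaleC_right = bounded_bilinear.bounded_linear_right[OF bounded_bilinear_scaleC]
lemmas scaleC_diff_right = bounded_bilinear.diff_right[OF bounded_bilinear_scaleC]

lemma unit_directionE:
  fixes x :: "'a::complex_normed_vector"
  assumes "x \<noteq> 0"
  obtains u where "norm u = 1" "of_real (norm x) *\<^sub>C u = x"
proof
  show "norm (of_real (inverse (norm x)) *\<^sub>C x) = 1"
    using assms by (simp add: norm_scaleC norm_inverse)
  show "of_real (norm x) *\<^sub>C of_real (inverse (norm x)) *\<^sub>C x = x"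
    using assms by (simp add: scaleC_scaleC scaleC_one)
qed

text \<open>Uniqueness of the derivative identifies \<open>frechet_derivative\<close> with the
  complex-linear witness of holomorphy.\<close>

lemma cholomorphic_on_frechet_derivative:
  assumes "cholomorphic_on F S" "x \<in> S"
  shows "bounded_clinear (frechet_derivative F (at x))"
    and "(F has_derivative frechet_derivative F (at x)) (at x)"
  using assms frechet_derivative_at unfolding cholomorphic_on_def by metis+

text \<open>The function \<open>g\<close> of the overview, kept scalar-valued so that one-variable
  theory applies to it.\<close>

definition radial_deriv :: "('a::complex_normed_vector \<Rightarrow> complex) \<Rightarrow> 'a \<Rightarrow> complex"
  where "radial_deriv f x = f x + frechet_derivative f (at x) x"

lemma radial_deriv_zero:
  assumes "cholomorphic_on f S" "0 \<in> S"
  shows "radial_deriv f 0 = f 0"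
proof -
  have "frechet_derivative f (at 0) 0 = 0"
    using cholomorphic_on_frechet_derivative(2)[OF assms]
    by (intro linear_0) (auto dest: has_derivative_linear)
  then show ?thesis
    by (simp add: radial_deriv_def)
qed

lemma has_derivative_radial_map:
  fixes f :: "'a::complex_normed_vector \<Rightarrow> complex"
  assumes f: "cholomorphic_on f S" and F: "\<And>x. x \<in> S \<Longrightarrow> F x = f x *\<^sub>C x" and x: "x \<in> S"
  shows "(F has_derivative (\<lambda>v. f x *\<^sub>C v + frechet_derivative f (at x) v *\<^sub>C x)) (at x)"
proof (rule has_derivative_transform_within_open)
  show "((\<lambda>x. f x *\<^sub>C x) has_derivative
      (\<lambda>v. f x *\<^sub>C v + frechet_derivative f (at x) v *\<^sub>C x)) (at x)"
    by (rule has_derivative_scaleC[OF cholomorphic_on_frechet_derivative(2)[OF f x] has_derivative_ident])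
  show "open S" using f by (simp add: cholomorphic_on_def)
qed (use F x in auto)

lemma frechet_derivative_radial_map:
  fixes f :: "'a::complex_normed_vector \<Rightarrow> complex"
  assumes "cholomorphic_on f S" "\<And>x. x \<in> S \<Longrightarrow> F x = f x *\<^sub>C x" "x \<in> S"
  shows "frechet_derivative F (at x) x = radial_deriv f x *\<^sub>C x"
  using frechet_derivative_at[OF has_derivative_radial_map[OF assms], THEN fun_cong, of x]
  by (simp add: radial_deriv_def scaleC_add_left)

text \<open>Complex linearity of the derivative of \<open>f\<close> makes the slice complex
  differentiable. The vector \<open>u\<close> is arbitrary, because later slices pass through target
  points of any norm.\<close>

lemma slice_has_field_derivative:
  fixes f :: "'a::complex_normed_vector \<Rightarrow> complex"
  assumes f: "cholomorphic_on f S" and z: "z *\<^sub>C u \<in> S"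
  shows "((\<lambda>z. z * f (z *\<^sub>C u)) has_field_derivative radial_deriv f (z *\<^sub>C u)) (at z)"
proof -
  define L where "L = frechet_derivative f (at (z *\<^sub>C u))"
  have L: "bounded_clinear L" and der: "(f has_derivative L) (at (z *\<^sub>C u))"
    unfolding L_def by (rule cholomorphic_on_frechet_derivative[OF f z])+
  have lin: "L (c *\<^sub>C v) = c * L v" for c v
    using L by (simp add: bounded_clinear_def scaleC_complex_def)
  have "((\<lambda>z. z *\<^sub>C u) has_derivative (\<lambda>h. h *\<^sub>C u)) (at z)"
    by (rule bounded_linear_imp_has_derivative) (rule bounded_linear_scaleC_left)
  from has_derivative_compose[OF this der]
  have "((\<lambda>z. f (z *\<^sub>C u)) has_derivative (\<lambda>h. L u * h)) (at z)"
    by (simp add: lin mult.commute)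
  then have "((\<lambda>z. f (z *\<^sub>C u)) has_field_derivative L u) (at z)"
    by (simp add: has_field_derivative_def)
  from DERIV_mult[OF DERIV_ident this] show ?thesis
    by (simp add: radial_deriv_def L_def[symmetric] lin mult.commute)
qed

section \<open>A quantitative injectivity criterion and the growth function\<close>

text \<open>A quantitative Noshiro-Warschawski criterion: the mean value theorem for the component
  of \<open>h\<close> in the direction \<open>w - z\<close> along the segment joining the two
  points.\<close>

lemma norm_diff_ge_of_Re_deriv_ge:
  fixes h :: "complex \<Rightarrow> complex"
  assumes "convex S" and z: "z \<in> S" and w: "w \<in> S"
    and der: "\<And>x. x \<in> S \<Longrightarrow> (h has_field_derivative h' x) (at x)"
    and ge: "\<And>x. x \<in> S \<Longrightarrow> c \<le> Re (h' x)"
  shows "c * cmod (w - z) \<le> cmod (h w - h z)"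
proof (cases "w = z")
  case False
  define d where "d = w - z"
  define \<gamma> where "\<gamma> = (\<lambda>t. z + of_real t * d)"
  have \<gamma>: "\<gamma> t \<in> S" if "0 \<le> t" "t \<le> 1" for t
  proof -
    have "\<gamma> t = (1 - t) *\<^sub>R z + t *\<^sub>R w"
      by (simp add: \<gamma>_def d_def scaleR_conv_of_real algebra_simps)
    then show ?thesis
      using convexD_alt[OF \<open>convex S\<close> z w that] by simp
  qed
  define p where "p = (\<lambda>t. Re (cnj d * h (\<gamma> t)))"
  have "(p has_real_derivative (cmod d)\<^sup>2 * Re (h' (\<gamma> t))) (at t)" if "0 \<le> t" "t \<le> 1" for t
  proof -
    have "(\<gamma> has_vector_derivative d) (at t)"
      unfolding \<gamma>_def by (auto intro!: derivative_eq_intros)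
    from field_vector_diff_chain_at[OF this der[OF \<gamma>[OF that]]]
    have "((\<lambda>t. cnj d * h (\<gamma> t)) has_vector_derivative cnj d * (d * h' (\<gamma> t))) (at t)"
      by (intro has_vector_derivative_mult_right) (simp add: o_def)
    then have "(p has_real_derivative Re (cnj d * (d * h' (\<gamma> t)))) (at t)"
      unfolding p_def by (rule has_field_derivative_Re)
    moreover have "cnj d * (d * h' (\<gamma> t)) = of_real ((cmod d)\<^sup>2) * h' (\<gamma> t)"
      by (metis complex_norm_square mult.assoc mult.commute)
    ultimately show ?thesis
      by simp
  qed
  from MVT2[OF zero_less_one this]
  obtain t where t: "0 < t" "t < 1" "p 1 - p 0 = (1 - 0) * ((cmod d)\<^sup>2 * Re (h' (\<gamma> t)))"
    by blast
  have "(cmod d)\<^sup>2 * c \<le> (cmod d)\<^sup>2 * Re (h' (\<gamma> t))"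
    using t by (intro mult_left_mono ge \<gamma>) auto
  also have "\<dots> = Re (cnj d * (h w - h z))"
    using t by (simp add: p_def \<gamma>_def d_def algebra_simps)
  also have "\<dots> \<le> cmod d * cmod (h w - h z)"
    by (metis complex_Re_le_cmod complex_mod_cnj norm_mult)
  finally have "cmod d * (c * cmod d) \<le> cmod d * cmod (h w - h z)"
    by (simp add: power2_eq_square mult_ac)
  with False show ?thesis
    by (simp add: d_def)
qed simp

text \<open>The antiderivative of the bound in Bonk's theorem that vanishes at \<open>0\<close>.\<close>

definition Bonk_growth :: "real \<Rightarrow> real"
  where "Bonk_growth t = sqrt 3 / 4 * (1 - 3 * ((1 - sqrt 3 * t) / (sqrt 3 - t))\<^sup>2)"

lemma Bonk_growth_0 [simp]: "Bonk_growth 0 = 0"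
  by (simp add: Bonk_growth_def power_divide)

lemma Bonk_growth_end: "Bonk_growth (1 / sqrt 3) = sqrt 3 / 4"
  by (simp add: Bonk_growth_def)

lemma inverse_sqrt3_less: "1 / sqrt 3 < sqrt 3" "1 / sqrt 3 < 1"
  by (simp_all add: field_simps)

lemma Bonk_growth_has_derivative:
  assumes "t < sqrt 3"
  shows "(Bonk_growth has_real_derivative (1 - sqrt 3 * t) / (1 - 1 / sqrt 3 * t) ^ 3) (at t)"
proof -
  define q where "q = sqrt 3"
  have q: "q * q = 3" "0 < q" "t < q" using assms by (simp_all add: q_def)
  \<comment> \<open>In terms of \<open>X\<close> the growth function is quadratic, and the
    derivative of \<open>X\<close> has the constant numerator
    \<open>1 - q * q = - 2\<close>.\<close>
  define X where "X = (\<lambda>t. (1 - q * t) / (q - t))"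
  have "(X has_real_derivative (- q * (q - t) - (1 - q * t) * (- 1)) / ((q - t) * (q - t))) (at t)"
    using q unfolding X_def by (auto intro!: derivative_eq_intros)
  moreover have "(Bonk_growth has_real_derivative q / 4 * (- (3 * (2 * X t * D)))) (at t)"
    if "(X has_real_derivative D) (at t)" for D
    unfolding Bonk_growth_def[abs_def] q_def[symmetric] X_def[unfolded fun_eq_iff, rule_format, symmetric]
    using that by (auto intro!: derivative_eq_intros)
  ultimately have "(Bonk_growth has_real_derivative
      q / 4 * (- (3 * (2 * ((1 - q * t) / (q - t)) *
        ((- q * (q - t) - (1 - q * t) * (- 1)) / ((q - t) * (q - t))))))) (at t)"
    unfolding X_def by blast
  also have "- q * (q - t) - (1 - q * t) * (- 1) = 1 - q * q"
    by (simp add: algebra_simps)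
  also have "1 - q * q = - 2"
    using q by simp
  also have "q / 4 * (- (3 * (2 * ((1 - q * t) / (q - t)) * (- 2 / ((q - t) * (q - t))))))
      = 3 * q * (1 - q * t) / (q - t) ^ 3"
  proof -
    have "q / 4 * (- (3 * (2 * (a / b) * (- 2 / (b * b))))) = 3 * q * a / b ^ 3" for a b :: real
      by (simp add: power3_eq_cube mult_ac)
    then show ?thesis .
  qed
  also have "\<dots> = (1 - q * t) / (1 - 1 / q * t) ^ 3"
  proof -
    have "1 - 1 / q * t = (q - t) / q" using q by (simp add: field_simps)
    moreover have "q ^ 3 = 3 * q" using q by (simp add: power3_eq_cube)
    ultimately show ?thesis by (simp add: power_divide)
  qed
  finally show ?thesis by (simp add: q_def)
qed

section \<open>Distortion, growth and injectivity of radial Bloch maps\<close>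

text \<open>The conditions on \<open>bloch_class\<close> expressed through the multiplier
  \<open>f\<close> alone; \<open>bound\<close> is the Bloch norm condition after cancelling
  \<open>norm x\<close>.\<close>

locale radial_Bloch =
  fixes f :: "'a::complex_normed_vector \<Rightarrow> complex"
  assumes hol: "cholomorphic_on f (ball 0 1)"
    and at_zero: "f 0 = 1"
    and bound: "\<And>x. norm x < 1 \<Longrightarrow> (1 - (norm x)\<^sup>2) * cmod (radial_deriv f x) \<le> 1"
begin

lemma slice_deriv:
  assumes "norm (z *\<^sub>C u) < 1"
  shows "((\<lambda>z. z * f (z *\<^sub>C u)) has_field_derivative radial_deriv f (z *\<^sub>C u)) (at z)"
  using assms by (intro slice_has_field_derivative[OF hol]) simp

lemma Re_radial_deriv_ge:
  assumes x: "norm x \<le> 1 / sqrt 3"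
  shows "(1 - sqrt 3 * norm x) / (1 - 1 / sqrt 3 * norm x) ^ 3 \<le> Re (radial_deriv f x)"
proof (cases "x = 0")
  case True
  then show ?thesis
    by (simp add: radial_deriv_zero[OF hol] at_zero)
next
  case False
  obtain u where u: "norm u = 1" and xu: "of_real (norm x) *\<^sub>C u = x"
    using False by (rule unit_directionE)
  define g where "g = (\<lambda>z. radial_deriv f (z *\<^sub>C u))"
  have der: "((\<lambda>z. z * f (z *\<^sub>C u)) has_field_derivative g z) (at z)" if "z \<in> ball 0 1" for z
    unfolding g_def using that u by (intro slice_deriv) (simp add: norm_scaleC)
  then have "(\<lambda>z. z * f (z *\<^sub>C u)) holomorphic_on ball 0 1"
    unfolding holomorphic_on_def field_differentiable_def
    by (blast intro: has_field_derivative_at_within)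
  \<comment> \<open>Holomorphy of \<open>g\<close> comes from its being the derivative of a
    holomorphic slice; no regularity of the derivative of \<open>f\<close> in \<open>x\<close> has
    to be known.\<close>
  then have "deriv (\<lambda>z. z * f (z *\<^sub>C u)) holomorphic_on ball 0 1"
    by (rule holomorphic_deriv) simp
  then have "g holomorphic_on ball 0 1"
    by (rule holomorphic_transform) (use der in \<open>auto intro: DERIV_imp_deriv\<close>)
  moreover have "g 0 = 1"
    by (simp add: g_def radial_deriv_zero[OF hol] at_zero)
  moreover have "(1 - (cmod z)\<^sup>2) * cmod (g z) \<le> 1" if "cmod z < 1" for z
    using bound[of "z *\<^sub>C u"] that u by (simp add: g_def norm_scaleC)
  ultimately have "(1 - sqrt 3 * norm x) / (1 - 1 / sqrt 3 * norm x) ^ 3 \<le> Re (g (of_real (norm x)))"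
    using x by (intro Bonk_distortion) auto
  then show ?thesis
    by (simp add: g_def xu)
qed

text \<open>The cube in the denominator lies between \<open>0\<close> and \<open>1\<close>, so
  dropping it weakens the bound. What remains is uniform on the ball and positive when
  \<open>r < 1 / sqrt 3\<close>.\<close>

lemma Re_radial_deriv_ge_linear:
  assumes "norm x \<le> r" "r \<le> 1 / sqrt 3"
  shows "1 - sqrt 3 * r \<le> Re (radial_deriv f x)"
proof -
  define d where "d = 1 - 1 / sqrt 3 * norm x"
  have x: "norm x \<le> 1 / sqrt 3" using assms by linarith
  have "1 / sqrt 3 * norm x \<le> 1 / sqrt 3 * (1 / sqrt 3)"
    by (rule mult_left_mono[OF x]) simp
  also have "\<dots> = 1 / 3"
    by simp
  finally have d: "0 < d" "d \<le> 1"
    unfolding d_def by (linarith, simp)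
  have n: "0 \<le> 1 - sqrt 3 * norm x"
    using x by (simp add: field_simps)
  have "1 - sqrt 3 * r \<le> 1 - sqrt 3 * norm x"
    using assms by simp
  also have "\<dots> = (1 - sqrt 3 * norm x) / 1"
    by simp
  also have "\<dots> \<le> (1 - sqrt 3 * norm x) / d ^ 3"
    using d n by (intro divide_left_mono) (auto simp: power_le_one)
  also have "\<dots> \<le> Re (radial_deriv f x)"
    unfolding d_def by (rule Re_radial_deriv_ge[OF x])
  finally show ?thesis .
qed

text \<open>Integration of the distortion bound along a ray: the difference \<open>p\<close> has
  nonnegative derivative and vanishes at \<open>0\<close>.\<close>

lemma Bonk_growth_le:
  assumes x: "norm x \<le> 1 / sqrt 3"
  shows "Bonk_growth (norm x) \<le> norm (f x *\<^sub>C x)"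
proof (cases "x = 0")
  case False
  obtain u where u: "norm u = 1" and xu: "of_real (norm x) *\<^sub>C u = x"
    using False by (rule unit_directionE)
  define p where "p = (\<lambda>s. Re (of_real s * f (of_real s *\<^sub>C u)) - Bonk_growth s)"
  have "p 0 \<le> p (norm x)"
  proof (rule DERIV_nonneg_imp_nondecreasing[of 0 "norm x" p])
    fix s assume s: "0 \<le> s" "s \<le> norm x"
    then have s': "s \<le> 1 / sqrt 3" "s < sqrt 3" "s < 1"
      using x inverse_sqrt3_less by linarith+
    define b where "b = (1 - sqrt 3 * s) / (1 - 1 / sqrt 3 * s) ^ 3"
    have norm_su: "norm (of_real s *\<^sub>C u) = s"
      using s u by (simp add: norm_scaleC)
    have "((\<lambda>z. z * f (z *\<^sub>C u)) has_field_derivative radial_deriv f (of_real s *\<^sub>C u)) (at (of_real s))"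
      using s' by (intro slice_deriv) (simp add: norm_su)
    then have "((\<lambda>s. of_real s * f (of_real s *\<^sub>C u)) has_vector_derivative
        radial_deriv f (of_real s *\<^sub>C u)) (at s)"
      by (rule has_vector_derivative_real_field)
    then have "(p has_real_derivative Re (radial_deriv f (of_real s *\<^sub>C u)) - b) (at s)"
      unfolding p_def b_def
      by (intro DERIV_diff has_field_derivative_Re Bonk_growth_has_derivative s')
    moreover have "b \<le> Re (radial_deriv f (of_real s *\<^sub>C u))"
      using Re_radial_deriv_ge[of "of_real s *\<^sub>C u"] s' by (simp add: b_def norm_su)
    ultimately show "\<exists>y. (p has_real_derivative y) (at s) \<and> 0 \<le> y"
      by (metis diff_ge_0_iff_ge)
  qed simp
  then have "Bonk_growth (norm x) \<le> Re (of_real (norm x) * f x)"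
    by (simp add: p_def xu)
  also have "\<dots> \<le> norm (f x *\<^sub>C x)"
    using complex_Re_le_cmod[of "of_real (norm x) * f x"]
    by (simp add: norm_scaleC norm_mult mult.commute)
  finally show ?thesis .
qed simp

text \<open>If \<open>F x = y\<close> and \<open>f x\<close> is nonzero, then
  \<open>s = 1 / f x\<close> solves \<open>s * f (s *\<^sub>C y) = 1\<close>. This estimate gives
  uniqueness and stability of the solution, with a constant that does not depend on
  \<open>y\<close>.\<close>

lemma ray_lower_Lipschitz:
  assumes s: "norm (s *\<^sub>C y) \<le> r" and t: "norm (t *\<^sub>C y) \<le> r" and r: "r \<le> 1 / sqrt 3"
  shows "(1 - sqrt 3 * r) * cmod (s - t) \<le> cmod (s * f (s *\<^sub>C y) - t * f (t *\<^sub>C y))"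
proof (rule norm_diff_ge_of_Re_deriv_ge)
  show "convex {z. norm (z *\<^sub>C y) \<le> r}"
  proof (rule convexI)
    fix z w :: complex and a b :: real
    assume *: "z \<in> {z. norm (z *\<^sub>C y) \<le> r}" "w \<in> {z. norm (z *\<^sub>C y) \<le> r}"
      and ab: "0 \<le> a" "0 \<le> b" "a + b = 1"
    have "(a *\<^sub>R z + b *\<^sub>R w) *\<^sub>C y = a *\<^sub>R (z *\<^sub>C y) + b *\<^sub>R (w *\<^sub>C y)"
      by (simp add: scaleR_scaleC scaleC_scaleC scaleC_add_left scaleC_complex_def)
    moreover have "norm (a *\<^sub>R (z *\<^sub>C y) + b *\<^sub>R (w *\<^sub>C y)) \<le> r"
      using convexD[OF convex_cball[of 0 r], of "z *\<^sub>C y" "w *\<^sub>C y" a b] * ab by simp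
    ultimately show "a *\<^sub>R z + b *\<^sub>R w \<in> {z. norm (z *\<^sub>C y) \<le> r}"
      by simp
  qed
  fix z assume z: "z \<in> {z. norm (z *\<^sub>C y) \<le> r}"
  then have "norm (z *\<^sub>C y) \<le> r"
    by simp
  then have "norm (z *\<^sub>C y) < 1"
    using r inverse_sqrt3_less(2) by linarith
  then show "((\<lambda>z. z * f (z *\<^sub>C y)) has_field_derivative radial_deriv f (z *\<^sub>C y)) (at z)"
    by (rule slice_deriv)
  show "1 - sqrt 3 * r \<le> Re (radial_deriv f (z *\<^sub>C y))"
    using z r by (intro Re_radial_deriv_ge_linear) auto
qed (use s t in auto)

text \<open>Compare the parameters \<open>1\<close> and \<open>0\<close> on the line through
  \<open>x\<close>.\<close>

lemma multiplier_nonzero: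
  assumes "norm x < 1 / sqrt 3"
  shows "f x \<noteq> 0"
proof
  assume "f x = 0"
  have "(1 - sqrt 3 * norm x) * cmod (1 - 0) \<le> cmod (1 * f (1 *\<^sub>C x) - 0 * f (0 *\<^sub>C x))"
    using assms by (intro ray_lower_Lipschitz) (auto simp: scaleC_one)
  then show False
    using assms \<open>f x = 0\<close> by (simp add: scaleC_one field_simps)
qed

text \<open>Two preimages of \<open>y\<close> are multiples of \<open>y\<close> by
  \<open>1 / f x\<close> and \<open>1 / f x'\<close>, and both factors solve the same scalar
  equation on the line through \<open>y\<close>.\<close>

lemma inj_on_radial_map:
  assumes F: "\<And>x. norm x < 1 \<Longrightarrow> F x = f x *\<^sub>C x" and r: "r < 1 / sqrt 3"
  shows "inj_on F (ball 0 r)"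
proof (rule inj_onI)
  fix x x' assume x: "x \<in> ball 0 r" and x': "x' \<in> ball 0 r" and eq: "F x = F x'"
  have r1: "r < 1" using r inverse_sqrt3_less(2) by linarith
  define y where "y = F x"
  have Fx: "y = f x *\<^sub>C x" "y = f x' *\<^sub>C x'"
    using F[of x] F[of x'] x x' r1 eq by (simp_all add: y_def)
  have nz: "f x \<noteq> 0" "f x' \<noteq> 0"
    using x x' r by (auto intro!: multiplier_nonzero)
  have inv: "(1 / f x) *\<^sub>C y = x" "(1 / f x') *\<^sub>C y = x'"
    using nz by (simp add: Fx(1) scaleC_scaleC scaleC_one, simp add: Fx(2) scaleC_scaleC scaleC_one)
  have "(1 - sqrt 3 * r) * cmod (1 / f x - 1 / f x') \<le> 0"
    using ray_lower_Lipschitz[of "1 / f x" y r "1 / f x'"] x x' r nz by (simp add: inv)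
  moreover have "0 < 1 - sqrt 3 * r"
    using r by (simp add: field_simps)
  ultimately have "1 / f x = 1 / f x'"
    by (simp add: mult_le_0_iff)
  then show "x = x'"
    using inv by metis
qed

section \<open>The schlicht ball centered at the origin\<close>

text \<open>On the slice through \<open>y\<close> the image of the disc is open, and the image of
  its boundary circle stays at distance at least \<open>Bonk_growth r\<close> from
  \<open>h 0 = 0\<close>, so the disc of that radius is covered.\<close>

lemma ball_subset_radial_image:
  assumes F: "\<And>x. norm x < 1 \<Longrightarrow> F x = f x *\<^sub>C x" and r: "0 < r" "r < 1 / sqrt 3"
    and pos: "0 < Bonk_growth r"
  shows "ball 0 (Bonk_growth r) \<subseteq> F ` ball 0 r"
proof
  fix y :: 'a assume y: "y \<in> ball 0 (Bonk_growth r)"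
  have r1: "r < 1" using r inverse_sqrt3_less(2) by linarith
  show "y \<in> F ` ball 0 r"
  proof (cases "y = 0")
    case True
    with F[of 0] r show ?thesis
      by (intro image_eqI[of _ _ 0]) simp_all
  next
    case False
    obtain u where u: "norm u = 1" and yu: "of_real (norm y) *\<^sub>C u = y"
      using False by (rule unit_directionE)
    define h where "h = (\<lambda>z. z * f (z *\<^sub>C u))"
    have hol_h: "h holomorphic_on ball 0 1"
    proof (rule holomorphic_onI)
      fix z :: complex assume "z \<in> ball 0 1"
      then have "(h has_field_derivative radial_deriv f (z *\<^sub>C u)) (at z)"
        unfolding h_def using u by (intro slice_deriv) (simp add: norm_scaleC)
      then show "h field_differentiable at z within ball 0 1"
        by (meson field_differentiable_def has_field_derivative_at_within)
    qed
    have "inj_on h (ball 0 r)"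
    proof (rule inj_onI)
      fix z w assume zw: "z \<in> ball 0 r" "w \<in> ball 0 r" "h z = h w"
      have "(1 - sqrt 3 * r) * cmod (z - w) \<le> 0"
        using ray_lower_Lipschitz[of z u r w] zw u r by (simp add: h_def norm_scaleC)
      moreover have "0 < 1 - sqrt 3 * r"
        using r by (simp add: field_simps)
      ultimately show "z = w"
        by (simp add: mult_le_0_iff)
    qed
    then have "open (h ` ball 0 r)"
      using hol_h r1 by (intro open_mapping_thm3) (auto intro: holomorphic_on_subset)
    moreover have "continuous_on (closure (ball 0 r)) h"
      using holomorphic_on_imp_continuous_on[OF hol_h] r r1
      by (rule_tac continuous_on_subset) (auto simp: closure_ball)
    moreover have "Bonk_growth r \<le> norm (h z - h 0)" if "z \<in> frontier (ball 0 r)" for z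
      using that r u Bonk_growth_le[of "z *\<^sub>C u"]
      by (simp add: frontier_ball h_def norm_scaleC norm_mult mult.commute)
    ultimately have "ball (h 0) (Bonk_growth r) \<subseteq> h ` ball 0 r"
      using r pos by (intro ball_subset_open_map_image) auto
    moreover have "of_real (norm y) \<in> ball (h 0) (Bonk_growth r)"
      using y by (simp add: h_def)
    ultimately obtain z where z: "cmod z < r" "h z = of_real (norm y)"
      by (metis imageE mem_ball_0 subsetD)
    have "F (z *\<^sub>C u) = y"
      using F[of "z *\<^sub>C u"] z r1 u yu by (simp add: h_def norm_scaleC scaleC_scaleC mult.commute)
    then show ?thesis
      using z u by (intro image_eqI[of _ _ "z *\<^sub>C u"]) (auto simp: norm_scaleC)
  qed
qed

lemma schlicht_ball_at_zero:
  assumes F: "\<And>x. norm x < 1 \<Longrightarrow> F x = f x *\<^sub>C x" and r: "0 < r" "r < 1 / sqrt 3"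
    and \<rho>: "0 < \<rho>" "\<rho> \<le> Bonk_growth r"
  shows "schlicht_ball F 0 \<rho>"
proof -
  have r1: "r < 1" using r inverse_sqrt3_less(2) by linarith
  have c: "0 < 1 - sqrt 3 * r"
    using r by (simp add: field_simps)
  have F0: "F 0 = 0" by (simp add: F)
  note derF = has_derivative_radial_map[OF hol, of F]
  \<comment> \<open>Cutting the ball down to this preimage makes the image exactly
    \<open>ball 0 \<rho>\<close>.\<close>
  define U where "U = {x \<in> ball 0 r. F x \<in> ball 0 \<rho>}"
  define G where "G = inv_into U F"
  have U: "U \<subseteq> ball 0 r" by (auto simp: U_def)
  have "continuous_on (ball 0 r) F"
  proof (rule continuous_at_imp_continuous_on, rule ballI)
    fix x :: 'a assume "x \<in> ball 0 r"
    then show "continuous (at x) F"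
      using F r1 by (intro has_derivative_continuous[OF derF]) auto
  qed
  then have openU: "open U"
    using continuous_open_preimage[of "ball 0 r" F "ball 0 \<rho>"]
    by (simp add: U_def vimage_def Int_def)
  have "inj_on F U"
    using inj_on_radial_map[of F r] F r U inj_on_subset by metis
  moreover have "F ` U = ball 0 \<rho>"
  proof
    have "ball 0 \<rho> \<subseteq> F ` ball 0 r"
      using ball_subset_radial_image[of F r] F r \<rho> by fastforce
    then show "ball 0 \<rho> \<subseteq> F ` U"
      unfolding U_def by blast
  qed (auto simp: U_def)
  ultimately have bij: "bij_betw F U (ball 0 \<rho>)"
    by (simp add: bij_betw_def)
  have G: "G y \<in> U" "F (G y) = y" if "y \<in> ball 0 \<rho>" for y
    using that bij unfolding G_def
    by (auto simp: bij_betw_def inv_into_into f_inv_into_f)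
  \<comment> \<open>The inverse moves points along complex lines,
    \<open>G y = s y *\<^sub>C y\<close>, so its continuity reduces to that of the scalar
    \<open>s\<close>.\<close>
  define s where "s = (\<lambda>y. 1 / f (G y))"
  have nz: "f (G y) \<noteq> 0" and sG: "s y *\<^sub>C y = G y" if "y \<in> ball 0 \<rho>" for y
  proof -
    have *: "norm (G y) < r" using G[OF that] U by auto
    then show "f (G y) \<noteq> 0" using r by (intro multiplier_nonzero) simp
    moreover have "y = f (G y) *\<^sub>C G y"
      using F[of "G y"] G[OF that] * r1 by simp
    ultimately show "s y *\<^sub>C y = G y"
      unfolding s_def by (metis scaleC_scaleC scaleC_one nonzero_eq_divide_eq)
  qed
  have holG: "\<exists>L. bounded_clinear L \<and> (G has_derivative L) (at y)" if y: "y \<in> ball 0 \<rho>" for y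
  proof -
    define x where "x = G y"
    have x: "norm x < r" using G[OF y] U by (auto simp: x_def)
    have sx: "s y *\<^sub>C y = x" using sG[OF y] by (simp add: x_def)
    have "(s \<longlongrightarrow> s y) (at y)"
    proof (rule Lim_null_comparison[THEN LIM_zero_cancel])
      have "((\<lambda>v. s y *\<^sub>C v) \<longlongrightarrow> x) (at y)"
        unfolding sx[symmetric] by (intro tendsto_scaleC tendsto_intros)
      then have "\<forall>\<^sub>F v in at y. norm (s y *\<^sub>C v) < r"
        using x by (intro order_tendstoD(2)[OF tendsto_norm])
      moreover have "\<forall>\<^sub>F v in at y. v \<in> ball 0 \<rho>"
        using y by (intro eventually_at_in_open') auto
      \<comment> \<open>On the slice through the nearby point \<open>v\<close>, \<open>s v\<close>
        solves the equation exactly and \<open>s y\<close> solves it up to an error tending to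
        \<open>0\<close>; the expansion estimate bounds their distance by that error.\<close>
      ultimately show "\<forall>\<^sub>F v in at y. norm (s v - s y)
          \<le> cmod (1 - s y * f (s y *\<^sub>C v)) / (1 - sqrt 3 * r)"
      proof eventually_elim
        case (elim v)
        have "norm (G v) < r" using G[OF elim(2)] U by auto
        then have "(1 - sqrt 3 * r) * cmod (s v - s y)
            \<le> cmod (s v * f (s v *\<^sub>C v) - s y * f (s y *\<^sub>C v))"
          using elim r by (intro ray_lower_Lipschitz) (auto simp: sG)
        moreover have "s v * f (s v *\<^sub>C v) = 1"
          using nz[OF elim(2)] by (simp add: sG[OF elim(2)]) (simp add: s_def)
        ultimately show ?case
          using c by (simp add: field_simps)
      qed
      have "isCont f x"
        using cholomorphic_on_frechet_derivative(2)[OF hol, of x] x r1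
        by (auto intro: has_derivative_continuous)
      then have "((\<lambda>v. f (s y *\<^sub>C v)) \<longlongrightarrow> f x) (at y)"
        using \<open>((\<lambda>v. s y *\<^sub>C v) \<longlongrightarrow> x) (at y)\<close> by (rule isCont_tendsto_compose)
      then have "((\<lambda>v. cmod (1 - s y * f (s y *\<^sub>C v)) / (1 - sqrt 3 * r))
          \<longlongrightarrow> cmod (1 - s y * f x) / (1 - sqrt 3 * r)) (at y)"
        using c by (intro tendsto_intros) auto
      moreover have "s y * f x = 1"
        using nz[OF y] by (simp add: s_def x_def)
      ultimately show "((\<lambda>v. cmod (1 - s y * f (s y *\<^sub>C v)) / (1 - sqrt 3 * r)) \<longlongrightarrow> 0) (at y)"
        by simp
    qed
    then have "((\<lambda>v. s v *\<^sub>C v) \<longlongrightarrow> x) (at y)"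
      unfolding sx[symmetric] by (intro tendsto_scaleC tendsto_intros)
    then have "(G \<longlongrightarrow> x) (at y)"
    proof (rule Lim_transform_eventually)
      have "\<forall>\<^sub>F v in at y. v \<in> ball 0 \<rho>"
        using y by (intro eventually_at_in_open') auto
      then show "\<forall>\<^sub>F v in at y. s v *\<^sub>C v = G v"
        by eventually_elim (rule sG)
    qed
    then have contG: "continuous (at y) G"
      by (simp add: continuous_at x_def)
    define f' where "f' = frechet_derivative f (at x)"
    define g where "g = radial_deriv f x"
    have f'_clin: "bounded_clinear f'"
      unfolding f'_def using x r1 by (intro cholomorphic_on_frechet_derivative(1)[OF hol]) simp
    then have f'_lin: "bounded_linear f'" and f'_scale: "f' (c *\<^sub>C v) = c * f' v" for c v
      by (simp_all add: bounded_clinear_def scaleC_complex_def)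
    interpret f': bounded_linear f' by (rule f'_lin)
    have "0 < Re g"
      using Re_radial_deriv_ge_linear[of x r] x r c by (simp add: g_def)
    then have g0: "g \<noteq> 0" by auto
    have g_eq: "g = f x + f' x" by (simp add: g_def radial_deriv_def f'_def)
    have fx: "f x \<noteq> 0" using nz[OF y] by (simp add: x_def)
    \<comment> \<open>Sherman--Morrison inverse of the derivative of \<open>F\<close> at \<open>x\<close>.\<close>
    define E where "E = (\<lambda>w. (1 / f x) *\<^sub>C (w - (f' w / g) *\<^sub>C x))"
    have derFx: "(F has_derivative (\<lambda>v. f x *\<^sub>C v + f' v *\<^sub>C x)) (at (G y))"
      using derF[of x] F x r1 by (simp add: f'_def x_def)
    have linE: "bounded_linear E"
      unfolding E_def
      by (intro bounded_linear_compose[OF bounded_linear_scaleC_right] bounded_linear_sub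
          bounded_linear_ident bounded_linear_compose[OF bounded_linear_scaleC_left]
          bounded_linear_compose[OF bounded_linear_divide] f'_lin)
    \<comment> \<open>Applying \<open>f'\<close> to the derivative of \<open>F\<close> at
      \<open>x\<close> multiplies \<open>f' v\<close> by \<open>g\<close>, which is why
      \<open>E\<close> divides by \<open>g\<close>. This left inverse, continuity of
      \<open>G\<close> and \<open>F (G v) = v\<close> on the ball give the derivative of
      \<open>G\<close>.\<close>
    have "E \<circ> (\<lambda>v. f x *\<^sub>C v + f' v *\<^sub>C x) = id"
    proof
      fix v
      have "f' (f x *\<^sub>C v + f' v *\<^sub>C x) / g = f' v"
        using g0 by (simp add: f'.add f'_scale g_eq field_simps)
      then show "(E \<circ> (\<lambda>v. f x *\<^sub>C v + f' v *\<^sub>C x)) v = id v"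
        using fx by (simp add: E_def scaleC_scaleC scaleC_one)
    qed
    then have "(G has_derivative E) (at y)"
      using G y by (intro has_derivative_inverse_basic[OF derFx linE _ contG, of "ball 0 \<rho>"]) auto
    moreover have "E (c *\<^sub>C v) = c *\<^sub>C E v" for c v
      by (simp add: E_def f'_scale scaleC_diff_right scaleC_scaleC mult_ac)
    ultimately show ?thesis
      using linE by (auto simp: bounded_clinear_def)
  qed
  have "\<exists>L. bounded_clinear L \<and> (F has_derivative L) (at x)" if "x \<in> U" for x
  proof -
    have x: "norm x < 1" using that U r1 by auto
    have fd: "bounded_clinear (frechet_derivative f (at x))"
      using x by (intro cholomorphic_on_frechet_derivative(1)[OF hol]) simp
    have d: "(F has_derivative (\<lambda>v. f x *\<^sub>C v + frechet_derivative f (at x) v *\<^sub>C x)) (at x)"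
      using derF[of x] F x by simp
    moreover have "bounded_clinear (\<lambda>v. f x *\<^sub>C v + frechet_derivative f (at x) v *\<^sub>C x)"
      using fd has_derivative_bounded_linear[OF d]
      by (simp add: bounded_clinear_def scaleC_complex_def scaleC_add_right scaleC_scaleC mult_ac)
    ultimately show ?thesis by blast
  qed
  then have "biholomorphic_onto F U (ball (F 0) \<rho>)"
    unfolding biholomorphic_onto_def cholomorphic_on_def F0 G_def[symmetric]
    using bij openU holG by auto
  moreover have "0 \<in> U" "U \<subseteq> ball 0 1"
    using r r1 \<rho> U by (auto simp: U_def F0)
  ultimately show ?thesis
    using \<rho> openU by (auto simp: schlicht_ball_def)
qed

text \<open>The center \<open>0\<close> suffices. Each \<open>r\<close> slightly below
  \<open>1 / sqrt 3\<close> gives a schlicht ball of radius \<open>Bonk_growth r\<close>, and these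
  radii tend to \<open>sqrt 3 / 4\<close>.\<close>

lemma schlicht_radius_ge:
  assumes F: "\<And>x. norm x < 1 \<Longrightarrow> F x = f x *\<^sub>C x"
  shows "ereal (sqrt 3 / 4) \<le> schlicht_radius F"
proof -
  have "ereal (sqrt 3 / 4) \<le> schlicht_radius_at 0 F"
  proof (rule tendsto_upperbound)
    have "isCont Bonk_growth (1 / sqrt 3)"
      by (intro DERIV_isCont[OF Bonk_growth_has_derivative] inverse_sqrt3_less)
    then have lim: "(Bonk_growth \<longlongrightarrow> sqrt 3 / 4) (at_left (1 / sqrt 3))"
      unfolding isCont_def Bonk_growth_end by (rule filterlim_mono) (auto simp: at_le)
    then show "((\<lambda>r. ereal (Bonk_growth r)) \<longlongrightarrow> ereal (sqrt 3 / 4)) (at_left (1 / sqrt 3))"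
      by simp
    have "\<forall>\<^sub>F r in at_left (1 / sqrt 3). 0 < Bonk_growth r"
      by (rule order_tendstoD(1)[OF lim]) simp
    moreover have "\<forall>\<^sub>F r in at_left (1 / sqrt 3). r \<in> {0<..<1 / sqrt 3}"
      by (rule eventually_at_leftI[of 0]) auto
    ultimately show "\<forall>\<^sub>F r in at_left (1 / sqrt 3). ereal (Bonk_growth r) \<le> schlicht_radius_at 0 F"
    proof eventually_elim
      case (elim r)
      then have "schlicht_ball F 0 (Bonk_growth r)"
        by (intro schlicht_ball_at_zero[OF F, where r = r]) auto
      then show ?case
        unfolding schlicht_radius_at_def by (intro Sup_upper) blast
    qed
  qed simp
  also have "\<dots> \<le> schlicht_radius F"
    unfolding schlicht_radius_def by (rule SUP_upper) simp
  finally show ?thesis .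
qed

end

section \<open>From the Bloch class to both assertions\<close>

lemma bloch_classE:
  fixes F :: "'a::complex_normed_vector \<Rightarrow> 'a"
  assumes "F \<in> bloch_class"
  obtains f where "radial_Bloch f" "\<And>x. norm x < 1 \<Longrightarrow> F x = f x *\<^sub>C x"
proof -
  from assms obtain f where f: "cholomorphic_on f (ball 0 1)" "f 0 = 1"
    and F: "\<And>x. norm x < 1 \<Longrightarrow> F x = f x *\<^sub>C x" and norm1: "bloch_norm F = 1"
    unfolding bloch_class_def by auto
  have bound: "(1 - (norm x)\<^sup>2) * cmod (radial_deriv f x) \<le> 1" if x: "norm x < 1" for x
  \<comment> \<open>The supremum in the Bloch norm omits the origin; there the bound is the equality
    \<open>f 0 = 1\<close>.\<close>
  proof (cases "x = 0")
    case True
    then show ?thesis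
      by (simp add: radial_deriv_zero[OF f(1)] f(2))
  next
    case False
    have "norm (frechet_derivative F (at x) x) / norm x = cmod (radial_deriv f x)"
      using frechet_derivative_radial_map[OF f(1), of F x] F x False by (simp add: norm_scaleC)
    then have "ereal ((1 - (norm x)\<^sup>2) * cmod (radial_deriv f x))
        = ereal ((1 - (norm x)\<^sup>2) * (norm (frechet_derivative F (at x) x) / norm x))"
      by simp
    also have "\<dots> \<le> (SUP x \<in> ball 0 1 - {0}.
        ereal ((1 - (norm x)\<^sup>2) * (norm (frechet_derivative F (at x) x) / norm x)))"
      using x False by (intro SUP_upper) simp
    also have "\<dots> = bloch_norm F"
      using F[of 0] by (simp add: bloch_norm_def)
    finally show ?thesis
      by (simp add: norm1)
  qed
  show thesis
    by (rule that[OF radial_Bloch.intro]) (use f F bound in auto)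
qed

theorem theorem3p14:
  assumes "(UNIV :: 'a::complex_banach set) \<noteq> {0}"
  shows "(\<forall>F \<in> (bloch_class :: ('a \<Rightarrow> 'a) set). \<forall>x l.
            0 < norm x \<and> norm x \<le> 1 / sqrt 3 \<and> l \<in> support_functionals x \<longrightarrow>
            Re (l (frechet_derivative F (at x) x)) \<ge>
              (1 - sqrt 3 * norm x) / (1 - 1 / sqrt 3 * norm x) ^ 3 * norm x)
       \<and> bloch_constant TYPE('a) \<ge> ereal (sqrt 3 / 4)"
proof (intro conjI ballI allI impI)
  fix F :: "'a \<Rightarrow> 'a" and x :: 'a and l
  assume F: "F \<in> bloch_class"
    and x: "0 < norm x \<and> norm x \<le> 1 / sqrt 3 \<and> l \<in> support_functionals x"
  obtain f where f: "radial_Bloch f" and Ff: "\<And>x. norm x < 1 \<Longrightarrow> F x = f x *\<^sub>C x"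
    by (rule bloch_classE[OF F]) blast
  interpret radial_Bloch f by (rule f)
  have "norm x < 1"
    using x inverse_sqrt3_less(2) by linarith
  \<comment> \<open>The derivative in direction \<open>x\<close> is a complex multiple of
    \<open>x\<close>, so every support functional gives the same value.\<close>
  then have "l (frechet_derivative F (at x) x) = radial_deriv f x * of_real (norm x)"
    using frechet_derivative_radial_map[OF hol, of F x] Ff x
    by (simp add: support_functionals_def bounded_clinear_def scaleC_complex_def)
  then have "Re (l (frechet_derivative F (at x) x)) = Re (radial_deriv f x) * norm x"
    by simp
  then show "Re (l (frechet_derivative F (at x) x)) \<ge>
      (1 - sqrt 3 * norm x) / (1 - 1 / sqrt 3 * norm x) ^ 3 * norm x"
    using mult_right_mono[OF Re_radial_deriv_ge[of x], of "norm x"] x by simp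
next
  show "ereal (sqrt 3 / 4) \<le> bloch_constant TYPE('a)"
    unfolding bloch_constant_def
  proof (rule INF_greatest)
    fix F :: "'a \<Rightarrow> 'a" assume "F \<in> bloch_class"
    then obtain f where "radial_Bloch f" "\<And>x. norm x < 1 \<Longrightarrow> F x = f x *\<^sub>C x"
      by (rule bloch_classE) blast
    then show "ereal (sqrt 3 / 4) \<le> schlicht_radius F"
      by (rule radial_Bloch.schlicht_radius_ge)
  qed
qed

end
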